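(* A three dimensional reproducing kernel Hilbert space $H$ is r-orthogonal if and only if it is an r-Pick space.
   Context: A finite dimensional reproducing kernel Hilbert space (RKHS) $H$ is a complex inner product space with a distinguished basis $\{k_i\}_{i=1}^n$ of vectors called reproducing kernels, indexed by a set $X(H)=\{x_i\}_{i=1}^n$; vectors are regarded as functions on $X(H)$ via $h(x_i)=\langle h,k_i\rangle$. Standing assumption: any two kernels are linearly independent and $\langle k_i,k_j\rangle\ne0$ for all $i,j$. Its Gram matrix is $G(H)=(\langle k_i,k_j\rangle)$. Two RKHS $H,\widetilde H$ of the same finite dimension are rescalings of each other, $H\sim\widetilde H$, if there are a bijection $\Xi:X(H)\to X(\widetilde H)$ and a nowhere vanishing $\gamma:X(H)\to\mathbb{C}$ such that $\langle\tilde k_{\Xi(x)},\tilde k_{\Xi(y)}\rangle=\gamma(x)\overline{\gamma(y)}\langle k_x,k_y\rangle$ for all $x,y\in X(H)$. $H$ is orthogonal if its Gram matrix $K$ satisfies $K^tK=I$; $H$ is r-orthogonal if it is a rescaling of an orthogonal RKHS. A Pick space is a space $DA_1(X)$ with $X$ a finite subset of the open unit disk: the span, in the Hardy space $H^2=DA_1$ with kernels $k_z(w)=(1-\bar zw)^{-1}$, of $\{k_x\}_{x\in X}$, with this set as distinguished basis. An r-Pick space is an RKHS that is a rescaling of a Pick space. *)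

theory Defs
  imports "HOL-Complex_Analysis.Complex_Analysis" "HOL-Library.Function_Algebras"
begin

section \<open>Complex inner product spaces\<close>

text \<open>
  The inner product is linear in the first and conjugate linear in the second argument.  The
  space is a subspace \<open>V\<close> of an ambient complex vector space, the type \<open>'v\<close>, and the inner
  product is only constrained on \<open>V\<close>.
\<close>

locale complex_inner_product_space = vector_space scale
  for scale :: "complex \<Rightarrow> 'v::ab_group_add \<Rightarrow> 'v" +
  fixes V :: "'v set" and ip :: "'v \<Rightarrow> 'v \<Rightarrow> complex"
  assumes subspace_V: "subspace V"
    and ip_add_left: "f \<in> V \<Longrightarrow> g \<in> V \<Longrightarrow> h \<in> V \<Longrightarrow> ip (f + g) h = ip f h + ip g h"
    and ip_scale_left: "f \<in> V \<Longrightarrow> g \<in> V \<Longrightarrow> ip (scale c f) g = c * ip f g"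
    and ip_commute: "f \<in> V \<Longrightarrow> g \<in> V \<Longrightarrow> ip g f = cnj (ip f g)"
    and ip_self_pos: "f \<in> V \<Longrightarrow> f \<noteq> 0 \<Longrightarrow> 0 < Re (ip f f)"

section \<open>Finite dimensional reproducing kernel Hilbert spaces\<close>

record ('x, 'v) rkhs =
  points :: "'x set"
  vectors :: "'v set"
  scaling :: "complex \<Rightarrow> 'v \<Rightarrow> 'v"
  inner_prod :: "'v \<Rightarrow> 'v \<Rightarrow> complex"
  kernel :: "'x \<Rightarrow> 'v"

text \<open>
  That any two kernels are linearly independent is part of the kernels being a basis.
\<close>

locale finite_dim_rkhs =
  complex_inner_product_space "scaling H" "vectors H" "inner_prod H"
  for H :: "('x, 'v::ab_group_add) rkhs" +
  assumes finite_points: "finite (points H)"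
    and inj_on_kernel: "inj_on (kernel H) (points H)"
    and independent_kernel: "independent (kernel H ` points H)"
    and span_kernel: "span (kernel H ` points H) = vectors H"
    and kernel_nonorthogonal:
      "x \<in> points H \<Longrightarrow> y \<in> points H \<Longrightarrow> inner_prod H (kernel H x) (kernel H y) \<noteq> 0"

definition rkhs_dim :: "('x, 'v::ab_group_add) rkhs \<Rightarrow> nat" where
  "rkhs_dim H = vector_space.dim (scaling H) (vectors H)"

definition gram :: "('x, 'v) rkhs \<Rightarrow> 'x \<Rightarrow> 'x \<Rightarrow> complex" where
  "gram H x y = inner_prod H (kernel H x) (kernel H y)"

text \<open>The bijection forces two rescalings of each other to have the same dimension.\<close>

definition rescaling :: "('x, 'v) rkhs \<Rightarrow> ('y, 'w) rkhs \<Rightarrow> bool" (infix "\<sim>\<^sub>r" 50) where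
  "H \<sim>\<^sub>r H' \<longleftrightarrow> (\<exists>\<Xi> \<gamma>. bij_betw \<Xi> (points H) (points H') \<and> (\<forall>x\<in>points H. \<gamma> x \<noteq> 0) \<and>
     (\<forall>x\<in>points H. \<forall>y\<in>points H. gram H' (\<Xi> x) (\<Xi> y) = \<gamma> x * cnj (\<gamma> y) * gram H x y))"

text \<open>
  With \<open>K\<close> the Gram matrix, this is \<open>K\<^sup>t K = I\<close> for the plain (not the conjugate) transpose.
\<close>

definition orthogonal_rkhs :: "('x, 'v) rkhs \<Rightarrow> bool" where
  "orthogonal_rkhs H \<longleftrightarrow> (\<forall>x\<in>points H. \<forall>y\<in>points H.
     (\<Sum>z\<in>points H. gram H z x * gram H z y) = (if x = y then 1 else 0))"

text \<open>
  The orthogonal space is taken over the same types as \<open>H\<close>; the lemma \<open>r_orthogonalI\<close> below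
  shows that this is no restriction.
\<close>

definition r_orthogonal :: "('x, 'v::ab_group_add) rkhs \<Rightarrow> bool" where
  "r_orthogonal H \<longleftrightarrow>
     (\<exists>H' :: ('x, 'v) rkhs. finite_dim_rkhs H' \<and> orthogonal_rkhs H' \<and> H \<sim>\<^sub>r H')"

lemma (in complex_inner_product_space) ip_scale_right:
  assumes "f \<in> V" "g \<in> V"
  shows "ip f (scale c g) = cnj c * ip f g"
  using assms ip_commute ip_scale_left subspace_V
  by (metis complex_cnj_mult subspace_scale)

lemma r_orthogonalI:
  fixes H :: "('x, 'v::ab_group_add) rkhs" and H' :: "('y, 'w::ab_group_add) rkhs"
  assumes "finite_dim_rkhs H" "finite_dim_rkhs H'" "orthogonal_rkhs H'" "H \<sim>\<^sub>r H'"
  shows "r_orthogonal H"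
proof -
  interpret H: finite_dim_rkhs H by fact
  obtain \<Xi> \<gamma> where bij: "bij_betw \<Xi> (points H) (points H')"
    and nz: "\<And>x. x \<in> points H \<Longrightarrow> \<gamma> x \<noteq> 0"
    and gr: "\<And>x y. x \<in> points H \<Longrightarrow> y \<in> points H \<Longrightarrow>
               gram H' (\<Xi> x) (\<Xi> y) = \<gamma> x * cnj (\<gamma> y) * gram H x y"
    using assms(4) unfolding rescaling_def by blast
  define k where "k x = scaling H (\<gamma> x) (kernel H x)" for x
  define J where "J = H\<lparr>kernel := k\<rparr>"
  have kV: "kernel H x \<in> vectors H" if "x \<in> points H" for x
    using H.span_base[of "kernel H x" "kernel H ` points H"] that H.span_kernel by simp
  have gramJ: "gram J x y = \<gamma> x * cnj (\<gamma> y) * gram H x y"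
    if "x \<in> points H" "y \<in> points H" for x y
    using that kV H.subspace_scale[OF H.subspace_V]
    by (simp add: J_def gram_def k_def H.ip_scale_left H.ip_scale_right mult.assoc)
  have inj: "inj_on k (points H)"
  proof (rule inj_onI)
    fix x y assume xy: "x \<in> points H" "y \<in> points H" and eq: "k x = k y"
    show "x = y"
    proof (rule ccontr)
      assume "x \<noteq> y"
      then have ne: "kernel H x \<noteq> kernel H y"
        using xy H.inj_on_kernel by (auto simp: inj_on_def)
      have "kernel H x = scaling H (inverse (\<gamma> x)) (k x)"
        using nz[OF xy(1)] by (simp add: k_def H.scale_scale)
      also have "\<dots> = scaling H (inverse (\<gamma> x) * \<gamma> y) (kernel H y)"
        unfolding eq by (simp add: k_def H.scale_scale)
      also have "\<dots> \<in> H.span (kernel H ` points H - {kernel H x})"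
        using ne xy by (intro H.span_scale H.span_base) auto
      finally show False
        using H.independent_kernel imageI[OF xy(1), of "kernel H"]
        unfolding H.dependent_def by (elim notE) (rule bexI)
    qed
  qed
  have span_eq: "H.span (k ` points H) = vectors H"
  proof -
    have "k ` points H \<subseteq> H.span (kernel H ` points H)"
      unfolding k_def by (intro image_subsetI H.span_scale H.span_base imageI)
    moreover have "kernel H ` points H \<subseteq> H.span (k ` points H)"
    proof clarify
      fix x assume x: "x \<in> points H"
      have "kernel H x = scaling H (inverse (\<gamma> x)) (k x)"
        using nz[OF x] by (simp add: k_def H.scale_scale)
      also have "\<dots> \<in> H.span (k ` points H)"
        using x by (intro H.span_scale H.span_base) auto
      finally show "kernel H x \<in> H.span (k ` points H)" .
    qed
    ultimately show ?thesis
      by (simp add: H.span_eq flip: H.span_kernel)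
  qed
  have card: "card (k ` points H) = card (kernel H ` points H)"
    by (simp add: card_image inj H.inj_on_kernel)
  have indep: "H.independent (k ` points H)"
  proof -
    obtain B where B: "B \<subseteq> k ` points H" "H.independent B" "k ` points H \<subseteq> H.span B"
      by (rule H.maximal_independent_subset)
    have "H.span B = vectors H"
      using B(3) H.span_superset[of "k ` points H"] H.span_mono[OF B(1)]
      by (metis H.span_minimal H.subspace_span span_eq subset_antisym)
    then have "card B = card (k ` points H)"
      using H.dim_span_eq_card_independent[OF B(2)]
        H.dim_span_eq_card_independent[OF H.independent_kernel]
      by (simp add: card H.span_kernel)
    then have "B = k ` points H"
      by (intro card_subset_eq B(1)) (simp_all add: H.finite_points)
    with B(2) show ?thesis by simp
  qed
  have "inner_prod H (k x) (k y) \<noteq> 0" if "x \<in> points H" "y \<in> points H" for x y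
    using gramJ[OF that] nz that H.kernel_nonorthogonal by (simp add: J_def gram_def)
  then have "finite_dim_rkhs J"
    using H.complex_inner_product_space_axioms H.finite_points inj indep span_eq
    by (simp add: J_def finite_dim_rkhs_def finite_dim_rkhs_axioms_def)
  moreover have "orthogonal_rkhs J"
    unfolding orthogonal_rkhs_def
  proof (intro ballI)
    fix x y assume "x \<in> points J" "y \<in> points J"
    then have xy: "x \<in> points H" "y \<in> points H" by (simp_all add: J_def)
    have "(\<Sum>z\<in>points J. gram J z x * gram J z y) =
          (\<Sum>z\<in>points H. gram H' (\<Xi> z) (\<Xi> x) * gram H' (\<Xi> z) (\<Xi> y))"
    proof (rule sum.cong)
      show "points J = points H" by (simp add: J_def)
    qed (simp only: gr gramJ xy)
    also have "\<dots> = (\<Sum>z\<in>points H'. gram H' z (\<Xi> x) * gram H' z (\<Xi> y))"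
      by (rule sum.reindex_bij_betw[OF bij])
    also have "\<dots> = (if \<Xi> x = \<Xi> y then 1 else 0)"
      using assms(3) xy bij unfolding orthogonal_rkhs_def bij_betw_def by blast
    also have "\<dots> = (if x = y then 1 else 0)"
      using xy bij by (auto simp: bij_betw_def inj_on_def)
    finally show "(\<Sum>z\<in>points J. gram J z x * gram J z y) = (if x = y then 1 else 0)" .
  qed
  moreover have "H \<sim>\<^sub>r J"
    unfolding rescaling_def
    by (rule exI[of _ id], rule exI[of _ \<gamma>]) (use nz gramJ in \<open>auto simp: J_def\<close>)
  ultimately show ?thesis unfolding r_orthogonal_def by blast
qed

section \<open>The Hardy space and Pick spaces\<close>

text \<open>
  Elements of the Hardy space are functions on the open unit disk; as HOL functions they are
  extended by zero, so that equality of functions is equality on the disk.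
\<close>

definition fun_scale :: "complex \<Rightarrow> (complex \<Rightarrow> complex) \<Rightarrow> complex \<Rightarrow> complex" where
  "fun_scale c f = (\<lambda>z. c * f z)"

definition taylor_coeff :: "(complex \<Rightarrow> complex) \<Rightarrow> nat \<Rightarrow> complex" where
  "taylor_coeff f n = fps_nth (fps_expansion f 0) n"

definition hardy_space :: "(complex \<Rightarrow> complex) set" where
  "hardy_space = {f. f holomorphic_on ball 0 1 \<and> (\<forall>z. z \<notin> ball 0 1 \<longrightarrow> f z = 0) \<and>
                     summable (\<lambda>n. (cmod (taylor_coeff f n))\<^sup>2)}"

definition hardy_inner :: "(complex \<Rightarrow> complex) \<Rightarrow> (complex \<Rightarrow> complex) \<Rightarrow> complex" where
  "hardy_inner f g = (\<Sum>n. taylor_coeff f n * cnj (taylor_coeff g n))"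

definition hardy_kernel :: "complex \<Rightarrow> complex \<Rightarrow> complex" where
  "hardy_kernel z w = (if w \<in> ball 0 1 then 1 / (1 - cnj z * w) else 0)"

definition DA\<^sub>1 :: "complex set \<Rightarrow> (complex, complex \<Rightarrow> complex) rkhs" where
  "DA\<^sub>1 X = \<lparr>points = X, vectors = module.span fun_scale (hardy_kernel ` X),
            scaling = fun_scale, inner_prod = hardy_inner, kernel = hardy_kernel\<rparr>"

definition pick_space :: "(complex, complex \<Rightarrow> complex) rkhs \<Rightarrow> bool" where
  "pick_space P \<longleftrightarrow> (\<exists>X. finite X \<and> X \<subseteq> ball 0 1 \<and> P = DA\<^sub>1 X)"

definition r_pick :: "('x, 'v) rkhs \<Rightarrow> bool" where
  "r_pick H \<longleftrightarrow> (\<exists>P. pick_space P \<and> H \<sim>\<^sub>r P)"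

subsection \<open>The Hardy space is a reproducing kernel inner product space\<close>

interpretation fun_scale: vector_space fun_scale
  by unfold_locales (auto simp: fun_scale_def fun_eq_iff algebra_simps)

lemma taylor_coeff_sums:
  assumes "f holomorphic_on ball 0 1" "z \<in> ball 0 1"
  shows "(\<lambda>n. taylor_coeff f n * z ^ n) sums f z"
  using holomorphic_power_series[OF assms] by (simp add: taylor_coeff_def fps_expansion_def)

lemma taylor_coeff_add:
  assumes "f holomorphic_on ball 0 1" "g holomorphic_on ball 0 1"
  shows "taylor_coeff (f + g) n = taylor_coeff f n + taylor_coeff g n"
  using higher_deriv_add[OF assms, of 0 n]
  by (simp add: taylor_coeff_def fps_expansion_def plus_fun_def add_divide_distrib)

lemma taylor_coeff_scale:
  assumes "f holomorphic_on ball 0 1"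
  shows "taylor_coeff (fun_scale c f) n = c * taylor_coeff f n"
  using higher_deriv_cmult[OF assms, of 0 n c]
  by (simp add: taylor_coeff_def fps_expansion_def fun_scale_def)

lemma hardy_inner_summable:
  assumes "f \<in> hardy_space" "g \<in> hardy_space"
  shows "summable (\<lambda>n. taylor_coeff f n * cnj (taylor_coeff g n))"
proof (rule summable_comparison_test[OF exI[of _ 0]])
  show "summable (\<lambda>n. (cmod (taylor_coeff f n))\<^sup>2 + (cmod (taylor_coeff g n))\<^sup>2)"
    using assms by (auto simp: hardy_space_def intro: summable_add)
  show "\<forall>n\<ge>0. cmod (taylor_coeff f n * cnj (taylor_coeff g n))
          \<le> (cmod (taylor_coeff f n))\<^sup>2 + (cmod (taylor_coeff g n))\<^sup>2"
  proof (intro allI impI)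
    fix n
    have "0 \<le> (cmod (taylor_coeff f n) - cmod (taylor_coeff g n))\<^sup>2" by simp
    moreover have "0 \<le> cmod (taylor_coeff f n) * cmod (taylor_coeff g n)" by simp
    ultimately show "cmod (taylor_coeff f n * cnj (taylor_coeff g n))
          \<le> (cmod (taylor_coeff f n))\<^sup>2 + (cmod (taylor_coeff g n))\<^sup>2"
      unfolding norm_mult complex_mod_cnj power2_diff by linarith
  qed
qed

lemma subspace_hardy_space: "fun_scale.subspace hardy_space"
proof (rule fun_scale.subspaceI)
  have "taylor_coeff 0 n = 0" for n
    using taylor_coeff_scale[of "\<lambda>_. 0" 0 n] by (simp add: fun_scale_def zero_fun_def)
  then show "0 \<in> hardy_space" by (simp add: hardy_space_def zero_fun_def)
next
  fix f g assume fg: "f \<in> hardy_space" "g \<in> hardy_space"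
  have "summable (\<lambda>n. (cmod (taylor_coeff f n + taylor_coeff g n))\<^sup>2)"
  proof (rule summable_comparison_test[OF exI[of _ 0]])
    show "summable (\<lambda>n. 2 * (cmod (taylor_coeff f n))\<^sup>2 + 2 * (cmod (taylor_coeff g n))\<^sup>2)"
      using fg by (auto simp: hardy_space_def intro: summable_add summable_mult)
    show "\<forall>n\<ge>0. norm ((cmod (taylor_coeff f n + taylor_coeff g n))\<^sup>2)
            \<le> 2 * (cmod (taylor_coeff f n))\<^sup>2 + 2 * (cmod (taylor_coeff g n))\<^sup>2"
    proof (intro allI impI)
      fix n
      have "(cmod (taylor_coeff f n + taylor_coeff g n))\<^sup>2
              \<le> (cmod (taylor_coeff f n) + cmod (taylor_coeff g n))\<^sup>2"
        by (intro power_mono norm_triangle_ineq) auto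
      moreover have "0 \<le> (cmod (taylor_coeff f n) - cmod (taylor_coeff g n))\<^sup>2" by simp
      ultimately show "norm ((cmod (taylor_coeff f n + taylor_coeff g n))\<^sup>2)
            \<le> 2 * (cmod (taylor_coeff f n))\<^sup>2 + 2 * (cmod (taylor_coeff g n))\<^sup>2"
        by (simp add: power2_diff power2_sum)
    qed
  qed
  moreover have "f + g holomorphic_on ball 0 1"
    using fg unfolding plus_fun_def by (auto simp: hardy_space_def intro: holomorphic_on_add)
  ultimately show "f + g \<in> hardy_space"
    using fg by (simp add: hardy_space_def taylor_coeff_add)
next
  fix c f assume f: "f \<in> hardy_space"
  then have "fun_scale c f holomorphic_on ball 0 1"
    unfolding fun_scale_def by (auto simp: hardy_space_def intro: holomorphic_intros)
  moreover have "fun_scale c f z = 0" if "z \<notin> ball 0 1" for z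
    using f that by (simp add: hardy_space_def fun_scale_def)
  ultimately show "fun_scale c f \<in> hardy_space"
    using f by (simp add: hardy_space_def taylor_coeff_scale norm_mult power_mult_distrib
        summable_mult)
qed

interpretation hardy: complex_inner_product_space fun_scale hardy_space hardy_inner
proof unfold_locales
  fix f g :: "complex \<Rightarrow> complex" assume "f \<in> hardy_space" "g \<in> hardy_space"
  from hardy_inner_summable[OF this]
  show "hardy_inner g f = cnj (hardy_inner f g)"
    unfolding hardy_inner_def
    by (subst bounded_linear.suminf[OF bounded_linear_cnj]) (simp_all add: mult.commute)
next
  fix f g :: "complex \<Rightarrow> complex" and c assume fg: "f \<in> hardy_space" "g \<in> hardy_space"
  with hardy_inner_summable[OF this]
  show "hardy_inner (fun_scale c f) g = c * hardy_inner f g"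
    by (auto simp: hardy_inner_def taylor_coeff_scale hardy_space_def mult.assoc suminf_mult)
next
  fix f g h :: "complex \<Rightarrow> complex"
  assume fgh: "f \<in> hardy_space" "g \<in> hardy_space" "h \<in> hardy_space"
  with suminf_add[OF hardy_inner_summable[OF fgh(1,3)] hardy_inner_summable[OF fgh(2,3)]]
  show "hardy_inner (f + g) h = hardy_inner f h + hardy_inner g h"
    by (auto simp: hardy_inner_def taylor_coeff_add hardy_space_def algebra_simps)
next
  fix f :: "complex \<Rightarrow> complex" assume f: "f \<in> hardy_space" "f \<noteq> 0"
  have "\<exists>n. taylor_coeff f n \<noteq> 0"
  proof (rule ccontr)
    assume *: "\<nexists>n. taylor_coeff f n \<noteq> 0"
    have "f z = 0" for z
    proof (cases "z \<in> ball 0 1")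
      case True
      then have "(\<lambda>n. taylor_coeff f n * z ^ n) sums f z"
        using f by (intro taylor_coeff_sums) (auto simp: hardy_space_def)
      with * show ?thesis using sums_unique2[OF _ sums_zero] by simp
    qed (use f in \<open>auto simp: hardy_space_def\<close>)
    with f(2) show False by (auto simp: fun_eq_iff)
  qed
  then obtain n where n: "taylor_coeff f n \<noteq> 0" by blast
  have sm: "summable (\<lambda>n. (cmod (taylor_coeff f n))\<^sup>2)"
    using f(1) by (simp add: hardy_space_def)
  have "Re (hardy_inner f f) = (\<Sum>n. (cmod (taylor_coeff f n))\<^sup>2)"
    unfolding hardy_inner_def
    by (subst Re_suminf[OF hardy_inner_summable[OF f(1) f(1)]])
      (simp only: complex_norm_square[symmetric] Re_complex_of_real)
  also have "\<dots> > 0"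
    by (rule suminf_pos2[OF sm, of n]) (use n in auto)
  finally show "0 < Re (hardy_inner f f)" .
qed (use subspace_hardy_space in auto)

lemma one_minus_cnj_mult_nonzero:
  assumes "z \<in> ball 0 1" "w \<in> ball 0 1"
  shows "1 - cnj z * w \<noteq> 0"
proof
  assume "1 - cnj z * w = 0"
  then have "cmod (cnj z * w) = 1" by simp
  moreover have "cmod z * cmod w < 1 * 1"
    using assms by (intro mult_strict_mono') auto
  ultimately show False by (simp add: norm_mult)
qed

lemma hardy_kernel_holomorphic:
  assumes "z \<in> ball 0 1"
  shows "hardy_kernel z holomorphic_on ball 0 1"
proof (rule holomorphic_transform)
  show "(\<lambda>w. 1 / (1 - cnj z * w)) holomorphic_on ball 0 1"
    by (intro holomorphic_intros one_minus_cnj_mult_nonzero assms)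
qed (simp add: hardy_kernel_def)

lemma taylor_coeff_hardy_kernel:
  assumes "z \<in> ball 0 1"
  shows "taylor_coeff (hardy_kernel z) n = cnj z ^ n"
proof -
  have "hardy_kernel z has_fps_expansion Abs_fps (\<lambda>n. cnj z ^ n)"
  proof (rule has_fps_expansionI)
    have "\<forall>\<^sub>F u in nhds 0. u \<in> ball (0::complex) 1"
      by (rule eventually_nhds_in_open) auto
    then show "\<forall>\<^sub>F u in nhds 0. (\<lambda>n. fps_nth (Abs_fps (\<lambda>n. cnj z ^ n)) n * u ^ n) sums hardy_kernel z u"
    proof eventually_elim
      case (elim u)
      have "cmod z * cmod u < 1 * 1"
        using assms elim by (intro mult_strict_mono') auto
      then have "(\<lambda>n. (cnj z * u) ^ n) sums (1 / (1 - cnj z * u))"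
        by (intro geometric_sums) (simp add: norm_mult)
      with elim show ?case by (simp add: hardy_kernel_def power_mult_distrib)
    qed
  qed
  then show ?thesis
    unfolding taylor_coeff_def fps_expansion_def using fps_nth_fps_expansion by fastforce
qed

lemma hardy_kernel_in_hardy_space:
  assumes "z \<in> ball 0 1"
  shows "hardy_kernel z \<in> hardy_space"
proof -
  have "(cmod z)\<^sup>2 < 1" using assms by (simp add: abs_square_less_1)
  then have "summable (\<lambda>n. ((cmod z)\<^sup>2) ^ n)" by (intro summable_geometric) simp
  then have "summable (\<lambda>n. (cmod (taylor_coeff (hardy_kernel z) n))\<^sup>2)"
    by (simp add: taylor_coeff_hardy_kernel[OF assms] norm_power power_mult[symmetric] mult.commute)
  then show ?thesis
    using hardy_kernel_holomorphic[OF assms] by (auto simp: hardy_space_def hardy_kernel_def)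
qed

lemma hardy_inner_kernel:
  assumes "f \<in> hardy_space" "z \<in> ball 0 1"
  shows "hardy_inner f (hardy_kernel z) = f z"
proof -
  have "(\<lambda>n. taylor_coeff f n * z ^ n) sums f z"
    using assms by (intro taylor_coeff_sums) (auto simp: hardy_space_def)
  then show ?thesis
    unfolding hardy_inner_def taylor_coeff_hardy_kernel[OF assms(2)]
    by (simp add: sums_iff)
qed

subsection \<open>Pick spaces are finite dimensional RKHS\<close>

lemma hardy_kernel_independent_aux:
  assumes fin: "finite X" and X: "X \<subseteq> ball 0 1"
    and zero: "(\<Sum>x\<in>X. fun_scale (c x) (hardy_kernel x)) = 0" and x: "x \<in> X"
  shows "c x = 0"
proof -
  have coeff: "(\<Sum>y\<in>X. c y * cnj y ^ n) = 0" for n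
  proof -
    have "taylor_coeff (\<Sum>y\<in>Y. fun_scale (c y) (hardy_kernel y)) n = (\<Sum>y\<in>Y. c y * cnj y ^ n) \<and>
          (\<Sum>y\<in>Y. fun_scale (c y) (hardy_kernel y)) \<in> hardy_space"
      if "finite Y" "Y \<subseteq> X" for Y using that
    proof (induction Y)
      case empty
      show ?case
        using fun_scale.subspace_0[OF subspace_hardy_space]
          taylor_coeff_scale[of "\<lambda>_. 0" 0 n] by (simp add: fun_scale_def zero_fun_def)
    next
      case (insert y Y)
      then have y: "hardy_kernel y \<in> hardy_space" "y \<in> ball 0 1"
        using X hardy_kernel_in_hardy_space by auto
      then have sc: "fun_scale (c y) (hardy_kernel y) \<in> hardy_space"
        using fun_scale.subspace_scale[OF subspace_hardy_space] by blast
      have "taylor_coeff (fun_scale (c y) (hardy_kernel y)) n = c y * cnj y ^ n"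
        using y by (simp add: taylor_coeff_scale hardy_kernel_holomorphic taylor_coeff_hardy_kernel)
      moreover have hol: "f holomorphic_on ball 0 1" if "f \<in> hardy_space" for f
        using that by (simp add: hardy_space_def)
      moreover have IH: "taylor_coeff (\<Sum>y\<in>Y. fun_scale (c y) (hardy_kernel y)) n =
            (\<Sum>y\<in>Y. c y * cnj y ^ n)"
          "(\<Sum>y\<in>Y. fun_scale (c y) (hardy_kernel y)) \<in> hardy_space"
        using insert by auto
      ultimately show ?case
        using fun_scale.subspace_add[OF subspace_hardy_space sc IH(2)]
        by (simp only: sum.insert[OF insert.hyps] taylor_coeff_add[OF hol[OF sc] hol[OF IH(2)]])
    qed
    from this[OF fin order_refl] have "(\<Sum>y\<in>X. c y * cnj y ^ n) = taylor_coeff 0 n"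
      by (simp add: zero)
    also have "\<dots> = 0"
      using taylor_coeff_scale[of "\<lambda>_. 0" 0 n] by (simp add: fun_scale_def zero_fun_def)
    finally show ?thesis .
  qed
  define p where "p = (\<Prod>y\<in>X - {x}. [:- cnj y, 1:])"
  have p0: "poly p (cnj y) = 0" if "y \<in> X - {x}" for y
    using that fin by (force simp: p_def poly_prod)
  have px: "poly p (cnj x) \<noteq> 0"
    using fin by (auto simp: p_def poly_prod)
  have "(\<Sum>y\<in>X. c y * poly p (cnj y)) = (\<Sum>i\<le>degree p. coeff p i * (\<Sum>y\<in>X. c y * cnj y ^ i))"
    unfolding poly_altdef sum_distrib_left
    by (subst sum.swap) (simp add: mult.left_commute)
  also have "\<dots> = 0" by (simp add: coeff)
  finally have "(\<Sum>y\<in>X. c y * poly p (cnj y)) = 0" .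
  moreover have "(\<Sum>y\<in>X. c y * poly p (cnj y)) = c x * poly p (cnj x)"
    using fin x p0 by (subst sum.remove[of _ x]) auto
  ultimately show ?thesis using px by simp
qed

lemma inj_on_hardy_kernel:
  assumes "X \<subseteq> ball 0 1"
  shows "inj_on hardy_kernel X"
proof (rule inj_onI)
  fix x y assume xy: "x \<in> X" "y \<in> X" "hardy_kernel x = hardy_kernel y"
  then have "taylor_coeff (hardy_kernel x) 1 = taylor_coeff (hardy_kernel y) 1" by simp
  with xy assms show "x = y"
    by (metis complex_cnj_cancel_iff power_one_right subsetD taylor_coeff_hardy_kernel)
qed

lemma vectors_DA_subset:
  assumes "X \<subseteq> ball 0 1"
  shows "vectors (DA\<^sub>1 X) \<subseteq> hardy_space"
  using assms hardy_kernel_in_hardy_space unfolding DA\<^sub>1_def rkhs.simps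
  by (intro fun_scale.span_minimal subspace_hardy_space) auto

lemma finite_dim_rkhs_DA:
  assumes fin: "finite X" and X: "X \<subseteq> ball 0 1"
  shows "finite_dim_rkhs (DA\<^sub>1 X)"
proof -
  have inj: "inj_on hardy_kernel X" by (rule inj_on_hardy_kernel[OF X])
  have sub: "fun_scale.span (hardy_kernel ` X) \<subseteq> hardy_space"
    using vectors_DA_subset[OF X] by (simp add: DA\<^sub>1_def)
  have indep: "fun_scale.independent (hardy_kernel ` X)"
  proof (rule fun_scale.independent_if_scalars_zero)
    show "finite (hardy_kernel ` X)" using fin by simp
    fix u k assume 0: "(\<Sum>v\<in>hardy_kernel ` X. fun_scale (u v) v) = 0" and "k \<in> hardy_kernel ` X"
    then obtain x where x: "x \<in> X" "k = hardy_kernel x" by blast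
    from 0 have "(\<Sum>x\<in>X. fun_scale (u (hardy_kernel x)) (hardy_kernel x)) = 0"
      by (simp add: sum.reindex[OF inj] o_def)
    with hardy_kernel_independent_aux[where c = "\<lambda>x. u (hardy_kernel x)", OF fin X _ x(1)]
    show "u k = 0" by (simp add: x)
  qed
  have nz: "hardy_inner (hardy_kernel x) (hardy_kernel y) \<noteq> 0" if "x \<in> X" "y \<in> X" for x y
  proof -
    have "x \<in> ball 0 1" "y \<in> ball 0 1" using that X by auto
    then show ?thesis
      using one_minus_cnj_mult_nonzero[of x y] hardy_kernel_in_hardy_space[of x]
      by (subst hardy_inner_kernel) (auto simp: hardy_kernel_def)
  qed
  have "complex_inner_product_space fun_scale (fun_scale.span (hardy_kernel ` X)) hardy_inner"
  proof unfold_locales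
    show "fun_scale.subspace (fun_scale.span (hardy_kernel ` X))"
      by (rule fun_scale.subspace_span)
  qed (rule hardy.ip_add_left hardy.ip_scale_left hardy.ip_commute hardy.ip_self_pos;
      use sub in blast)+
  then show ?thesis
    by (auto simp: finite_dim_rkhs_def finite_dim_rkhs_axioms_def DA\<^sub>1_def fin inj indep nz)
qed

end

theory Submission
  imports Defs
begin

text \<open>
  Let \<open>K\<close> be the Gram matrix.  Fixing a base point \<open>a\<close>, \<open>H\<close> is a rescaling of a Pick space iff
  the matrix \<open>F\<^sub>i\<^sub>j = 1 - K\<^sub>i\<^sub>a K\<^sub>a\<^sub>j / (K\<^sub>a\<^sub>a K\<^sub>i\<^sub>j)\<close> has the form \<open>cnj \<xi>\<^sub>i * \<xi>\<^sub>j\<close>.  Row and column \<open>a\<close> of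
  \<open>F\<close> vanish, so for three points this is the vanishing of a \<open>2 \<times> 2\<close> determinant, which
  follows from the orthogonality of distinct columns of \<open>K\<close>.

  Conversely, the Gram matrix of a finite set \<open>X\<close> in the disk becomes orthogonal after rescaling by
  square roots of \<open>e\<^sub>x = (\<Prod>l\<in>X. 1 - l * cnj x) / (\<Prod>l\<in>X - {x}. cnj x - cnj l)\<close>.  These are residues:
  the orthogonality relations express that the residues of a rational function decaying like
  \<open>1 / z\<^sup>2\<close> sum to zero.
\<close>

section \<open>Rescalings\<close>

lemma rescaling_trans:
  assumes "H \<sim>\<^sub>r H'" "H' \<sim>\<^sub>r H''"
  shows "H \<sim>\<^sub>r H''"
proof -
  obtain f u where f: "bij_betw f (points H) (points H')" "\<forall>x\<in>points H. u x \<noteq> 0"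
    "\<forall>x\<in>points H. \<forall>y\<in>points H. gram H' (f x) (f y) = u x * cnj (u y) * gram H x y"
    using assms(1) unfolding rescaling_def by blast
  obtain g v where g: "bij_betw g (points H') (points H'')" "\<forall>x\<in>points H'. v x \<noteq> 0"
    "\<forall>x\<in>points H'. \<forall>y\<in>points H'. gram H'' (g x) (g y) = v x * cnj (v y) * gram H' x y"
    using assms(2) unfolding rescaling_def by blast
  have fH: "f x \<in> points H'" if "x \<in> points H" for x
    using f(1) that by (auto simp: bij_betw_def)
  show ?thesis
    unfolding rescaling_def
  proof (intro exI conjI ballI)
    show "bij_betw (g \<circ> f) (points H) (points H'')" by (rule bij_betw_trans[OF f(1) g(1)])
    show "v (f x) * u x \<noteq> 0" if "x \<in> points H" for x using that fH f(2) g(2) by simp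
    show "gram H'' ((g \<circ> f) x) ((g \<circ> f) y) = v (f x) * u x * cnj (v (f y) * u y) * gram H x y"
      if "x \<in> points H" "y \<in> points H" for x y
      using that fH f(3) g(3) by simp
  qed
qed

section \<open>Gram matrices and nonzero multiples of the kernels\<close>

context finite_dim_rkhs
begin

lemma card_points: "card (points H) = rkhs_dim H"
  using dim_span_eq_card_independent[OF independent_kernel]
  by (simp add: span_kernel rkhs_dim_def card_image inj_on_kernel)

lemma kernel_mem: "x \<in> points H \<Longrightarrow> kernel H x \<in> vectors H"
  using span_base[of "kernel H x" "kernel H ` points H"] span_kernel by simp

lemma gram_nonzero: "x \<in> points H \<Longrightarrow> y \<in> points H \<Longrightarrow> gram H x y \<noteq> 0"
  by (simp add: gram_def kernel_nonorthogonal)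

lemma gram_commute: "x \<in> points H \<Longrightarrow> y \<in> points H \<Longrightarrow> gram H y x = cnj (gram H x y)"
  unfolding gram_def by (intro ip_commute kernel_mem)

lemma kernel_not_multiple:
  assumes "x \<in> points H" "y \<in> points H" "x \<noteq> y"
  shows "kernel H x \<noteq> scaling H c (kernel H y)"
proof
  assume eq: "kernel H x = scaling H c (kernel H y)"
  have "kernel H y \<noteq> kernel H x" using assms inj_on_kernel by (auto simp: inj_on_def)
  then have "kernel H x \<in> span (kernel H ` points H - {kernel H x})"
    unfolding eq using assms eq by (intro span_scale span_base) auto
  then show False using independent_kernel assms(1) unfolding dependent_def by blast
qed

lemma gram_self:
  assumes "x \<in> points H"
  shows "gram H x x = of_real (Re (gram H x x))" "0 < Re (gram H x x)"
proof -
  show *: "gram H x x = of_real (Re (gram H x x))"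
    using gram_commute[OF assms assms] by (simp add: complex_eq_iff)
  have "kernel H x \<noteq> 0" using independent_kernel assms dependent_zero by (metis imageI)
  then show "0 < Re (gram H x x)" unfolding gram_def by (intro ip_self_pos kernel_mem assms)
qed

text \<open>Strictness comes from linear independence: the component of one kernel orthogonal to the
  other is nonzero, so it has positive norm.\<close>

lemma gram_strict_Cauchy_Schwarz:
  assumes x: "x \<in> points H" and y: "y \<in> points H" and "x \<noteq> y"
  shows "(cmod (gram H x y))\<^sup>2 < Re (gram H x x) * Re (gram H y y)"
proof -
  define q where "q = Re (gram H y y)"
  \<comment> \<open>This \<open>c\<close> makes \<open>kernel H x + g\<close> orthogonal to
    \<open>kernel H y\<close>; the squared norm of the sum is then
    \<open>Re (gram H x x) - (cmod (gram H x y))\<^sup>2 / q\<close>.\<close>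
  define c where "c = - gram H x y / of_real q"
  define g where "g = scaling H c (kernel H y)"
  have q: "q > 0" "gram H y y = of_real q" using gram_self[OF y] by (auto simp: q_def)
  have gV: "g \<in> vectors H"
    unfolding g_def by (rule subspace_scale[OF subspace_V kernel_mem[OF y]])
  have ne: "kernel H x + g \<noteq> 0"
  proof
    assume "kernel H x + g = 0"
    then have "kernel H x = scaling H (- c) (kernel H y)"
      by (simp add: g_def scale_minus_left eq_neg_iff_add_eq_0)
    then show False using kernel_not_multiple[OF assms] by blast
  qed
  have add_right: "inner_prod H f (kernel H x + g) = inner_prod H f (kernel H x) + inner_prod H f g"
    if "f \<in> vectors H" for f
  proof -
    have "inner_prod H f (kernel H x + g) = cnj (inner_prod H (kernel H x + g) f)"
      using that x gV by (intro ip_commute subspace_add[OF subspace_V] kernel_mem)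
    then show ?thesis
      using that x gV
      by (simp add: ip_add_left kernel_mem ip_commute[of "kernel H x" f] ip_commute[of g f])
  qed
  have "inner_prod H (kernel H x + g) (kernel H x + g)
      = gram H x x + cnj c * gram H x y + c * gram H y x + c * cnj c * gram H y y"
    using x y gV
    by (simp add: add_right ip_add_left subspace_add[OF subspace_V] kernel_mem)
       (simp add: g_def gram_def ip_scale_left ip_scale_right kernel_mem
          subspace_scale[OF subspace_V] mult.assoc)
  also have "\<dots> = gram H x x - gram H x y * cnj (gram H x y) / of_real q"
    using q unfolding c_def gram_commute[OF x y] by (simp add: field_simps)
  also have "\<dots> = gram H x x - of_real ((cmod (gram H x y))\<^sup>2 / q)"
    by (simp add: complex_norm_square del: of_real_power)
  finally have "0 < Re (gram H x x) - (cmod (gram H x y))\<^sup>2 / q"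
    using ip_self_pos[OF _ ne] x gV subspace_add[OF subspace_V] kernel_mem by simp
  then show ?thesis using q by (simp add: field_simps flip: q_def)
qed

text \<open>Every nowhere vanishing \<open>\<gamma>\<close> is realised inside the same vector
  space, so a rescaling can be constructed by prescribing its factors alone.\<close>

lemma
  assumes nz: "\<And>x. x \<in> points H \<Longrightarrow> \<gamma> x \<noteq> 0"
  defines "J \<equiv> H\<lparr>kernel := \<lambda>x. scaling H (\<gamma> x) (kernel H x)\<rparr>"
  shows gram_scale_kernel:
      "x \<in> points H \<Longrightarrow> y \<in> points H \<Longrightarrow> gram J x y = \<gamma> x * cnj (\<gamma> y) * gram H x y"
    and finite_dim_rkhs_scale_kernel: "finite_dim_rkhs J"
    and rescaling_scale_kernel: "H \<sim>\<^sub>r J"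
proof -
  define k where "k x = scaling H (\<gamma> x) (kernel H x)" for x
  have J: "J = H\<lparr>kernel := k\<rparr>" by (simp add: J_def k_def[abs_def])
  have gr: "gram J x y = \<gamma> x * cnj (\<gamma> y) * gram H x y"
    if "x \<in> points H" "y \<in> points H" for x y
    using that
    by (simp add: J gram_def k_def ip_scale_left ip_scale_right kernel_mem
        subspace_scale[OF subspace_V])
  then show "x \<in> points H \<Longrightarrow> y \<in> points H \<Longrightarrow> gram J x y = \<gamma> x * cnj (\<gamma> y) * gram H x y" .
  show "H \<sim>\<^sub>r J"
    unfolding rescaling_def
    by (rule exI[of _ id], rule exI[of _ \<gamma>]) (use nz gr in \<open>auto simp: J\<close>)
  have kernel_eq: "kernel H x = scaling H (inverse (\<gamma> x)) (k x)" if "x \<in> points H" for x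
    using nz[OF that] by (simp add: k_def)
  have inj: "inj_on k (points H)"
  proof (rule inj_onI, rule ccontr)
    fix x y assume xy: "x \<in> points H" "y \<in> points H" "k x = k y" "x \<noteq> y"
    have "kernel H x = scaling H (inverse (\<gamma> x)) (k y)"
      using kernel_eq[OF xy(1)] xy(3) by simp
    also have "\<dots> = scaling H (inverse (\<gamma> x) * \<gamma> y) (kernel H y)"
      by (simp add: k_def)
    finally show False using kernel_not_multiple xy by blast
  qed
  have "k ` points H \<subseteq> span (kernel H ` points H)"
    unfolding k_def by (intro image_subsetI span_scale span_base imageI)
  moreover have "kernel H ` points H \<subseteq> span (k ` points H)"
    by (intro image_subsetI, subst kernel_eq) (auto intro: span_scale span_base)
  ultimately have span: "span (k ` points H) = vectors H"
    by (simp add: span_eq flip: span_kernel)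
  have indep: "independent (k ` points H)"
  proof (rule independent_if_scalars_zero)
    fix u v assume 0: "(\<Sum>w\<in>k ` points H. scaling H (u w) w) = 0" and "v \<in> k ` points H"
    then obtain x where x: "x \<in> points H" "v = k x" by blast
    \<comment> \<open>\<open>r\<close> recovers a point from its kernel. It turns a linear relation
      among the new kernels into one among the old kernels, with coefficients multiplied by
      \<open>\<gamma>\<close>.\<close>
    define r where "r = the_inv_into (points H) (kernel H)"
    have r: "r (kernel H x) = x" if "x \<in> points H" for x
      using that by (simp add: r_def the_inv_into_f_f inj_on_kernel)
    have "(\<Sum>w\<in>kernel H ` points H. scaling H (u (k (r w)) * \<gamma> (r w)) w)
        = (\<Sum>x\<in>points H. scaling H (u (k x) * \<gamma> x) (kernel H x))"
      by (simp add: sum.reindex[OF inj_on_kernel] r)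
    also have "\<dots> = (\<Sum>x\<in>points H. scaling H (u (k x)) (k x))"
      by (simp add: k_def)
    also have "\<dots> = (\<Sum>w\<in>k ` points H. scaling H (u w) w)"
      by (simp add: sum.reindex[OF inj])
    finally have "(\<Sum>w\<in>kernel H ` points H. scaling H (u (k (r w)) * \<gamma> (r w)) w) = 0"
      by (simp add: 0)
    from independentD[OF independent_kernel _ order_refl this, of "kernel H x"]
    show "u v = 0" using x nz r by (simp add: finite_points)
  qed (simp add: finite_points)
  have "inner_prod H (k x) (k y) \<noteq> 0" if "x \<in> points H" "y \<in> points H" for x y
    using gr[OF that] nz that gram_nonzero by (simp add: J gram_def)
  then show "finite_dim_rkhs J"
    using complex_inner_product_space_axioms finite_points inj indep span
    by (simp add: J finite_dim_rkhs_def finite_dim_rkhs_axioms_def)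
qed

end

lemma gram_DA:
  assumes "x \<in> ball 0 1" "y \<in> ball 0 1"
  shows "gram (DA\<^sub>1 X) x y = 1 / (1 - cnj x * y)"
  using assms hardy_inner_kernel[OF hardy_kernel_in_hardy_space[OF assms(1)] assms(2)]
  by (simp add: gram_def DA\<^sub>1_def hardy_kernel_def)

section \<open>Orthogonal spaces are r-Pick\<close>

text \<open>Injectivity of \<open>\<xi>\<close> is automatic by the strict Cauchy--Schwarz inequality.\<close>

lemma (in finite_dim_rkhs) r_pickI:
  assumes \<gamma>: "\<And>x. x \<in> points H \<Longrightarrow> \<gamma> x \<noteq> 0"
    and \<xi>: "\<And>x. x \<in> points H \<Longrightarrow> \<xi> x \<in> ball 0 1"
    and eq: "\<And>x y. x \<in> points H \<Longrightarrow> y \<in> points H \<Longrightarrow>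
               1 / (1 - cnj (\<xi> x) * \<xi> y) = \<gamma> x * cnj (\<gamma> y) * gram H x y"
  shows "r_pick H"
proof -
  have "inj_on \<xi> (points H)"
  proof (rule inj_onI, rule ccontr)
    fix x y assume x: "x \<in> points H" and y: "y \<in> points H" and xy: "\<xi> x = \<xi> y" "x \<noteq> y"
    let ?g = "gram H"
    \<comment> \<open>As \<open>\<xi> x = \<xi> y\<close>, the four values of the Pick kernel at
      these points coincide. Cancelling the factors gives equality in Cauchy--Schwarz, a
      contradiction.\<close>
    have "\<gamma> x * cnj (\<gamma> y) * ?g x y * (\<gamma> y * cnj (\<gamma> x) * ?g y x)
        = \<gamma> x * cnj (\<gamma> x) * ?g x x * (\<gamma> y * cnj (\<gamma> y) * ?g y y)"
      by (simp only: xy(1) flip: eq[OF x x] eq[OF x y] eq[OF y x] eq[OF y y])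
    then have "?g x y * ?g y x = ?g x x * ?g y y"
      using \<gamma> x y by (simp add: mult_ac)
    then have "of_real ((cmod (?g x y))\<^sup>2) = of_real (Re (?g x x)) * complex_of_real (Re (?g y y))"
      using gram_commute[OF x y] gram_self(1)[OF x] gram_self(1)[OF y]
      by (metis complex_norm_square)
    then have "(cmod (?g x y))\<^sup>2 = Re (?g x x) * Re (?g y y)"
      by (metis of_real_eq_iff of_real_mult)
    then show False using gram_strict_Cauchy_Schwarz[OF x y xy(2)] by simp
  qed
  then have "bij_betw \<xi> (points H) (points (DA\<^sub>1 (\<xi> ` points H)))"
    by (simp add: DA\<^sub>1_def bij_betw_def)
  then have "H \<sim>\<^sub>r DA\<^sub>1 (\<xi> ` points H)"
    unfolding rescaling_def using \<gamma> \<xi> eq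
    by (intro exI[of _ \<xi>] exI[of _ \<gamma>] conjI ballI) (simp_all add: gram_DA del: mem_ball)
  moreover have "pick_space (DA\<^sub>1 (\<xi> ` points H))"
    unfolding pick_space_def using \<xi> finite_points by blast
  ultimately show ?thesis unfolding r_pick_def by blast
qed

text \<open>
  The two sides differ, up to sign, by the determinant of the \<open>3 \<times> 3\<close> matrix whose rows consist of
  the summands in the three assumptions, so each of its rows sums to zero.
\<close>

lemma orthogonal_columns_minors:
  fixes kaa :: "'a::idom"
  assumes "kaa * kab + kba * kbb + kca * kcb = 0"
    and "kaa * kac + kba * kbc + kca * kcc = 0"
    and "kab * kac + kbb * kbc + kcb * kcc = 0"
  shows "(kaa * kbb - kba * kab) * (kaa * kcc - kca * kac) * (kbc * kcb)
       = (kaa * kbc - kba * kac) * (kaa * kcb - kca * kab) * (kbb * kcc)"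
  using assms by algebra

lemma orthogonal_imp_r_pick:
  assumes "finite_dim_rkhs H" "card (points H) = 3" "orthogonal_rkhs H"
  shows "r_pick H"
proof -
  interpret finite_dim_rkhs H by fact
  obtain a b c where pts: "points H = {a, b, c}" and ne: "a \<noteq> b" "a \<noteq> c" "b \<noteq> c"
    using assms(2) by (auto simp: card_3_iff)
  define K where "K = gram H"
  \<comment> \<open>\<open>1 - F i j\<close> is the reciprocal of the Gram entry after the rescaling
    that turns row and column \<open>a\<close> into ones. For a Pick space with \<open>a\<close>
    placed at the origin it is \<open>1 - cnj (\<xi> i) * \<xi> j\<close>.\<close>
  define F where "F i j = 1 - K i a * K a j / (K a a * K i j)" for i j
  have K0: "K i j \<noteq> 0" if "i \<in> points H" "j \<in> points H" for i j
    unfolding K_def by (rule gram_nonzero[OF that])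
  have Kcnj: "cnj (K i j) = K j i" if "i \<in> points H" "j \<in> points H" for i j
    unfolding K_def using gram_commute[OF that] by simp
  have Fcnj: "cnj (F i j) = F j i" if "i \<in> points H" "j \<in> points H" for i j
    using that pts by (simp add: F_def Kcnj mult.commute)
  have Fself: "F i i = of_real (1 - (cmod (K i a))\<^sup>2 / (Re (K a a) * Re (K i i)))"
    if "i \<in> points H" for i
  proof -
    have "F i i = 1 - K i a * cnj (K i a) / (of_real (Re (K a a)) * of_real (Re (K i i)))"
      using gram_self(1)[of a] gram_self(1)[of i] that pts Kcnj[of i a] by (simp add: F_def K_def)
    then show ?thesis by (simp add: complex_norm_square del: of_real_power)
  qed
  \<comment> \<open>Positivity makes the square root \<open>s\<close> below nonzero. The upper bound
    that follows comes from \<open>K i a \<noteq> 0\<close> and places the points inside the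
    disk.\<close>
  have Fpos: "0 < Re (F i i)" if "i \<in> points H" "i \<noteq> a" for i
    using gram_strict_Cauchy_Schwarz[of i a] that gram_self(2)[of a] gram_self(2)[of i] pts
    by (simp add: Fself K_def field_simps)
  have Flt: "Re (F i i) < 1" if "i \<in> points H" for i
    using that gram_self(2)[of a] gram_self(2)[of i] pts K0[of i a]
    by (simp add: Fself K_def)
  have Fa: "F a j = 0" "F j a = 0" if "j \<in> points H" for j
    using that K0 pts by (auto simp: F_def)
  have det: "F b b * F c c = F b c * F c b"
  proof -
    have orth: "K a x * K a y + K b x * K b y + K c x * K c y = 0"
      if "x \<in> points H" "y \<in> points H" "x \<noteq> y" for x y
      using assms(3) that ne unfolding orthogonal_rkhs_def K_def pts by (force simp: add.assoc)
    \<comment> \<open>The \<open>2 \<times> 2\<close> minors are the numerators of the entries of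
      \<open>F\<close>; the factors \<open>K b c * K c b\<close> and \<open>K b b * K c c\<close>
      arise from cross-multiplying the denominators.\<close>
    have "(K a a * K b b - K b a * K a b) * (K a a * K c c - K c a * K a c) * (K b c * K c b)
        = (K a a * K b c - K b a * K a c) * (K a a * K c b - K c a * K a b) * (K b b * K c c)"
      by (rule orthogonal_columns_minors; rule orth) (use pts ne in auto)
    moreover have "F i j = (K a a * K i j - K i a * K a j) / (K a a * K i j)"
      if "i \<in> points H" "j \<in> points H" for i j
      using K0[OF that] K0[of a a] pts by (simp add: F_def diff_divide_distrib)
    ultimately show ?thesis
      using K0 pts by (simp add: frac_eq_eq mult_ac)
  qed
  define s where "s = sqrt (Re (F b b))"
  \<comment> \<open>Row \<open>a\<close> of \<open>F\<close> vanishes, which suggests the origin for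
    \<open>a\<close>. A rotation allows \<open>\<xi> b\<close> to be real and positive, and then
    \<open>cnj (\<xi> b) * \<xi> c = F b c\<close> forces \<open>\<xi> c\<close>; \<open>det\<close>
    supplies the remaining entry \<open>F c c\<close>.\<close>
  define \<xi> where "\<xi> i = (if i = a then 0 else if i = b then of_real s else F b c / of_real s)" for i
  have s: "s \<noteq> 0" "of_real s * of_real s = F b b"
  proof -
    have "Re (F b b) > 0" using Fpos pts ne by simp
    moreover have "F b b = of_real (Re (F b b))"
      using Fself[of b] pts by (metis Re_complex_of_real insertI1 insert_commute)
    ultimately show "s \<noteq> 0" "of_real s * of_real s = F b b"
      by (simp_all add: s_def flip: of_real_mult)
  qed
  have \<xi>F: "cnj (\<xi> i) * \<xi> j = F i j" if "i \<in> points H" "j \<in> points H" for i j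
  proof -
    have "cnj (F b c) = F c b" using Fcnj pts by simp
    moreover have "F b c * F c b / (of_real s * of_real s) = F c c"
      using s det by (metis divide_eq_eq mult.commute mult_eq_0_iff of_real_eq_0_iff)
    ultimately show ?thesis
      using that Fa s ne unfolding pts by (auto simp: \<xi>_def mult.commute)
  qed
  show ?thesis
  proof (rule r_pickI)
    fix x assume x: "x \<in> points H"
    have "of_real ((cmod (\<xi> x))\<^sup>2) = F x x"
      using \<xi>F[OF x x] by (simp add: complex_norm_square mult.commute del: of_real_power)
    then have "(cmod (\<xi> x))\<^sup>2 < 1"
      using Flt[OF x] by (metis Re_complex_of_real)
    then show "\<xi> x \<in> ball 0 1" by (simp add: abs_square_less_1)
    \<comment> \<open>The factor splits \<open>K a a / (K x a * K a y)\<close> into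
      \<open>\<gamma> x * cnj (\<gamma> y)\<close>, using
      \<open>K a y = cnj (K y a)\<close>.\<close>
    show "of_real (sqrt (Re (K a a))) / K x a \<noteq> 0"
      using gram_self(2)[of a] pts K0 x by (simp add: K_def)
  next
    fix x y assume xy: "x \<in> points H" "y \<in> points H"
    define r where "r = sqrt (Re (K a a))"
    have r: "of_real r * of_real r = K a a"
      using gram_self[of a] pts by (simp add: r_def K_def flip: of_real_mult)
    have "1 / (1 - cnj (\<xi> x) * \<xi> y) = K a a * K x y / (K x a * K a y)"
      using \<xi>F[OF xy] by (simp add: F_def)
    also have "\<dots> = of_real r / K x a * (of_real r / K a y) * K x y"
      by (simp add: r flip: r)
    also have "\<dots> = of_real r / K x a * cnj (of_real r / K y a) * K x y"
      using Kcnj[of y a] xy pts by simp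
    finally show "1 / (1 - cnj (\<xi> x) * \<xi> y) = of_real (sqrt (Re (K a a))) / K x a *
        cnj (of_real (sqrt (Re (K a a))) / K y a) * gram H x y"
      by (simp add: r_def K_def)
  qed
qed

section \<open>Pick spaces are r-orthogonal\<close>

text \<open>These are the residues of \<open>(1 - R * z) / ((z - p) * (z - q) * (z - r))\<close>.
  Equivalently, the second divided difference of a linear function is zero.\<close>

lemma sum_residues_linear:
  fixes p q r :: "'a::field"
  assumes "p \<noteq> q" "p \<noteq> r" "q \<noteq> r"
  shows "(1 - R * p) / ((p - q) * (p - r)) + (1 - R * q) / ((q - p) * (q - r))
       + (1 - R * r) / ((r - p) * (r - q)) = 0"
proof -
  \<comment> \<open>\<open>D\<close> is a Vandermonde product serving as common denominator; the
    cyclic differences \<open>q - r\<close>, \<open>r - p\<close>, \<open>p - q\<close> absorb the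
    signs.\<close>
  define D where "D = (p - q) * (p - r) * (q - r)"
  have D: "D \<noteq> 0" using assms by (simp add: D_def)
  have clear: "x / y = x * z / D" if "y * z = D" for x y z
    using that D by auto
  have "(1 - R * p) / ((p - q) * (p - r)) + (1 - R * q) / ((q - p) * (q - r))
       + (1 - R * r) / ((r - p) * (r - q))
     = (1 - R * p) * (q - r) / D + (1 - R * q) * (r - p) / D + (1 - R * r) * (p - q) / D"
    by (intro arg_cong2[of _ _ _ _ "(+)"] clear) (simp_all add: D_def algebra_simps)
  also have "\<dots> = 0"
    unfolding add_divide_distrib[symmetric] by (simp add: algebra_simps)
  finally show ?thesis .
qed

text \<open>The left side sums the residues at \<open>p\<close>, \<open>q\<close>, \<open>r\<close>
  of \<open>(1 - Q * z) * (1 - R * z) / ((1 - P * z) * (z - p) * (z - q) * (z - r))\<close>. For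
  \<open>P \<noteq> 0\<close> the right side is minus the residue at the fourth pole
  \<open>1 / P\<close>.\<close>

lemma sum_residues_quadratic:
  fixes p q r :: "'a::field"
  assumes "p \<noteq> q" "p \<noteq> r" "q \<noteq> r" "1 - P * p \<noteq> 0" "1 - P * q \<noteq> 0" "1 - P * r \<noteq> 0"
  shows "(1 - Q * p) * (1 - R * p) / ((1 - P * p) * ((p - q) * (p - r)))
       + (1 - Q * q) * (1 - R * q) / ((1 - P * q) * ((q - p) * (q - r)))
       + (1 - Q * r) * (1 - R * r) / ((1 - P * r) * ((r - p) * (r - q)))
       = (P - Q) * (P - R) / ((1 - P * p) * (1 - P * q) * (1 - P * r))"
proof -
  define D where "D = (p - q) * (p - r) * (q - r)"
  define u v w where "u = 1 - P * p" and "v = 1 - P * q" and "w = 1 - P * r"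
  have D: "D \<noteq> 0" using assms by (simp add: D_def)
  have uvw: "u \<noteq> 0" "v \<noteq> 0" "w \<noteq> 0" using assms by (simp_all add: u_def v_def w_def)
  have clear: "x / (t * y) = x * z / (t * D)" if "y * z = D" for x y z t
    using that D by auto
  have "(1 - Q * p) * (1 - R * p) / (u * ((p - q) * (p - r)))
       + (1 - Q * q) * (1 - R * q) / (v * ((q - p) * (q - r)))
       + (1 - Q * r) * (1 - R * r) / (w * ((r - p) * (r - q)))
     = (1 - Q * p) * (1 - R * p) * (q - r) / (u * D)
       + (1 - Q * q) * (1 - R * q) * (r - p) / (v * D)
       + (1 - Q * r) * (1 - R * r) * (p - q) / (w * D)"
    by (intro arg_cong2[of _ _ _ _ "(+)"] clear) (simp_all add: D_def algebra_simps)
  also have "\<dots> = ((1 - Q * p) * (1 - R * p) * (q - r) * (v * w)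
       + (1 - Q * q) * (1 - R * q) * (r - p) * (u * w)
       + (1 - Q * r) * (1 - R * r) * (p - q) * (u * v)) / (u * v * w * D)"
    using uvw D by (simp add: add_divide_distrib mult.assoc)
  also have "(1 - Q * p) * (1 - R * p) * (q - r) * (v * w)
       + (1 - Q * q) * (1 - R * q) * (r - p) * (u * w)
       + (1 - Q * r) * (1 - R * r) * (p - q) * (u * v) = (P - Q) * (P - R) * D"
    unfolding u_def v_def w_def D_def by algebra
  finally show ?thesis using D by (simp add: u_def v_def w_def)
qed

section \<open>Residue weights and the orthogonality relations\<close>

text \<open>For finite \<open>X\<close> in the disk this is the residue at \<open>cnj x\<close> of
  the reciprocal of the Blaschke product with simple zeros at the conjugates of the points of
  \<open>X\<close>.\<close>

definition residue_weight :: "complex set \<Rightarrow> complex \<Rightarrow> complex" where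
  "residue_weight X x = (\<Prod>l\<in>X. 1 - l * cnj x) / (\<Prod>l\<in>X - {x}. cnj x - cnj l)"

lemma residue_weight_nonzero:
  assumes "finite X" "X \<subseteq> ball 0 1" "x \<in> X"
  shows "residue_weight X x \<noteq> 0"
  using assms one_minus_cnj_mult_nonzero[of x]
  by (auto simp: residue_weight_def mult.commute subset_iff)

lemma residue_weight_3:
  assumes "a \<noteq> b" "a \<noteq> c" "b \<noteq> c"
  shows "residue_weight {a, b, c} a = (1 - a * cnj a) * (1 - b * cnj a) * (1 - c * cnj a) /
           ((cnj a - cnj b) * (cnj a - cnj c))"
    and "residue_weight {a, b, c} b = (1 - a * cnj b) * (1 - b * cnj b) * (1 - c * cnj b) /
           ((cnj b - cnj a) * (cnj b - cnj c))"
    and "residue_weight {a, b, c} c = (1 - a * cnj c) * (1 - b * cnj c) * (1 - c * cnj c) /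
           ((cnj c - cnj a) * (cnj c - cnj b))"
  using assms by (simp_all add: residue_weight_def insert_Diff_if mult.assoc)

text \<open>The denominators cancel two factors of each weight and leave
  \<open>1 - c * cnj z\<close>, so this is the linear residue identity at the conjugate points with
  \<open>R = c\<close>.\<close>

lemma residue_weight_sum_off_diagonal:
  assumes ne: "a \<noteq> b" "a \<noteq> c" "b \<noteq> c" and ball: "{a, b, c} \<subseteq> ball 0 1"
  shows "(\<Sum>z\<in>{a, b, c}. residue_weight {a, b, c} z / ((1 - cnj z * a) * (1 - cnj z * b))) = 0"
proof -
  have nz: "1 - x * cnj z \<noteq> 0" if "x \<in> {a, b, c}" "z \<in> {a, b, c}" for x z
    using that ball one_minus_cnj_mult_nonzero[of z x] by (simp only: mult.commute) blast
  have "cnj a \<noteq> cnj b" "cnj a \<noteq> cnj c" "cnj b \<noteq> cnj c" using ne by auto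
  note sum_residues_linear[OF this, of c]
  then show ?thesis
    using ne nz by (simp add: residue_weight_3 mult.commute[of "cnj _"] add.assoc)
qed

text \<open>One factor \<open>1 - a * cnj z\<close> cancels and the other stays as a denominator:
  the quadratic residue identity with \<open>P = a\<close>, \<open>Q = b\<close>,
  \<open>R = c\<close>. Its value is the reciprocal of the conjugated weight at
  \<open>a\<close>.\<close>

lemma residue_weight_sum_diagonal:
  assumes ne: "a \<noteq> b" "a \<noteq> c" "b \<noteq> c" and ball: "{a, b, c} \<subseteq> ball 0 1"
  shows "cnj (residue_weight {a, b, c} a) *
    (\<Sum>z\<in>{a, b, c}. residue_weight {a, b, c} z / (1 - cnj z * a)\<^sup>2) = 1"
proof -
  have nz: "1 - x * cnj z \<noteq> 0" if "x \<in> {a, b, c}" "z \<in> {a, b, c}" for x z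
    using that ball one_minus_cnj_mult_nonzero[of z x] by (simp only: mult.commute) blast
  have "cnj a \<noteq> cnj b" "cnj a \<noteq> cnj c" "cnj b \<noteq> cnj c" using ne by auto
  note * = sum_residues_quadratic[OF this, of a b c]
  have "1 - a * cnj a \<noteq> 0" "1 - a * cnj b \<noteq> 0" "1 - a * cnj c \<noteq> 0" using nz by simp_all
  note * = *[OF this]
  have "(\<Sum>z\<in>{a, b, c}. residue_weight {a, b, c} z / (1 - cnj z * a)\<^sup>2)
      = (a - b) * (a - c) / ((1 - a * cnj a) * (1 - a * cnj b) * (1 - a * cnj c))"
    unfolding *[symmetric] using ne nz
    by (simp add: residue_weight_3 mult_ac add.assoc power2_eq_square)
  moreover have "cnj (residue_weight {a, b, c} a) =
      (1 - a * cnj a) * (1 - a * cnj b) * (1 - a * cnj c) / ((a - b) * (a - c))"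
    using ne by (simp add: residue_weight_3 mult.commute[of "cnj _"])
  ultimately show ?thesis using ne nz by simp
qed

lemma pick_3_imp_r_orthogonal:
  assumes X: "X \<subseteq> ball 0 1" "card X = 3"
  shows "\<exists>P' :: (complex, complex \<Rightarrow> complex) rkhs.
    finite_dim_rkhs P' \<and> orthogonal_rkhs P' \<and> DA\<^sub>1 X \<sim>\<^sub>r P'"
proof -
  have fin: "finite X" using X(2) by (simp add: card_ge_0_finite)
  interpret P: finite_dim_rkhs "DA\<^sub>1 X" by (rule finite_dim_rkhs_DA[OF fin X(1)])
  \<comment> \<open>The transpose in the orthogonality condition is not conjugated, so
    \<open>d z\<close> enters the sums as \<open>d z * d z\<close>; hence a complex square root of
    the weight.\<close>
  define d where "d x = csqrt (residue_weight X x)" for x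
  have pts: "points (DA\<^sub>1 X) = X" by (simp add: DA\<^sub>1_def)
  have d0: "d x \<noteq> 0" if "x \<in> points (DA\<^sub>1 X)" for x
    using residue_weight_nonzero[OF fin X(1)] that by (simp add: d_def pts)
  define J where "J = DA\<^sub>1 X\<lparr>kernel := \<lambda>x. scaling (DA\<^sub>1 X) (d x) (kernel (DA\<^sub>1 X) x)\<rparr>"
  have grJ: "gram J x y = d x * cnj (d y) / (1 - cnj x * y)" if "x \<in> X" "y \<in> X" for x y
    using P.gram_scale_kernel[of d x y, OF d0, folded J_def] that X(1)
    by (simp add: pts gram_DA subset_iff)
  have dd: "d x * d x = residue_weight X x" for x
    by (simp add: d_def flip: power2_eq_square)
  have summand: "gram J z x * gram J z y =
      cnj (d x * d y) * (residue_weight X z / ((1 - cnj z * x) * (1 - cnj z * y)))"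
    if "x \<in> X" "y \<in> X" "z \<in> X" for x y z
    using that by (simp add: grJ mult_ac flip: dd)
  have "orthogonal_rkhs J"
    unfolding orthogonal_rkhs_def
  proof (intro ballI)
    fix x y assume "x \<in> points J" "y \<in> points J"
    then have xy: "x \<in> X" "y \<in> X" by (simp_all add: J_def pts)
    have "(\<Sum>z\<in>points J. gram J z x * gram J z y) = (\<Sum>z\<in>X. gram J z x * gram J z y)"
      by (simp add: J_def pts)
    also have "\<dots> = cnj (d x * d y) *
        (\<Sum>z\<in>X. residue_weight X z / ((1 - cnj z * x) * (1 - cnj z * y)))"
      unfolding sum_distrib_left by (intro sum.cong refl summand xy)
    also have "\<dots> = (if x = y then 1 else 0)"
    proof (cases "x = y")
      case True
      \<comment> \<open>The points are listed with \<open>x\<close> first, or with \<open>x\<close>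
        and \<open>y\<close> first in the other case, to match the roles of \<open>a\<close> and
        \<open>b\<close> in the two sum lemmas.\<close>
      have "\<exists>b c. X = {x, b, c} \<and> x \<noteq> b \<and> x \<noteq> c \<and> b \<noteq> c"
        using X(2) xy(1) by (auto simp: card_3_iff)
      then obtain b c where "X = {x, b, c}" "x \<noteq> b" "x \<noteq> c" "b \<noteq> c" by blast
      then show ?thesis
        using residue_weight_sum_diagonal[of x b c] X(1) True
        by (simp only: dd power2_eq_square if_True simp_thms)
    next
      case False
      have "\<exists>c. X = {x, y, c} \<and> x \<noteq> c \<and> y \<noteq> c"
        using X(2) xy False by (auto simp: card_3_iff)
      then obtain c where "X = {x, y, c}" "x \<noteq> c" "y \<noteq> c" by blast
      then show ?thesis
        using residue_weight_sum_off_diagonal[of x y c] X(1) False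
        by (simp only: if_False mult_zero_right simp_thms)
    qed
    finally show "(\<Sum>z\<in>points J. gram J z x * gram J z y) = (if x = y then 1 else 0)" .
  qed
  then show ?thesis
    using P.finite_dim_rkhs_scale_kernel[of d, OF d0, folded J_def]
      P.rescaling_scale_kernel[of d, OF d0, folded J_def] by blast
qed

theorem theorem29:
  fixes H :: "('x, 'v::ab_group_add) rkhs"
  assumes "finite_dim_rkhs H" and "rkhs_dim H = 3"
  shows "r_orthogonal H \<longleftrightarrow> r_pick H"
proof
  have card: "card (points H) = 3"
    using finite_dim_rkhs.card_points[OF assms(1)] assms(2) by simp
  {
    assume "r_orthogonal H"
    then obtain H' :: "('x, 'v) rkhs"
      where H': "finite_dim_rkhs H'" "orthogonal_rkhs H'" "H \<sim>\<^sub>r H'"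
      unfolding r_orthogonal_def by blast
    have "card (points H') = 3"
      using H'(3) card bij_betw_same_card unfolding rescaling_def by metis
    then have "r_pick H'" by (intro orthogonal_imp_r_pick H')
    then show "r_pick H" unfolding r_pick_def using rescaling_trans[OF H'(3)] by blast
  next
    assume "r_pick H"
    then obtain X where X: "X \<subseteq> ball 0 1" "H \<sim>\<^sub>r DA\<^sub>1 X"
      unfolding r_pick_def pick_space_def by blast
    have "card (points (DA\<^sub>1 X)) = 3"
      using X(2) card bij_betw_same_card unfolding rescaling_def by metis
    then obtain P' :: "(complex, complex \<Rightarrow> complex) rkhs"
      where "finite_dim_rkhs P'" "orthogonal_rkhs P'" "DA\<^sub>1 X \<sim>\<^sub>r P'"
      using pick_3_imp_r_orthogonal[OF X(1)] by (auto simp: DA\<^sub>1_def)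
    \<comment> \<open>\<open>P'\<close> lives over the types of the Pick space;
      \<open>r_orthogonalI\<close> transfers orthogonality back to the types of
      \<open>H\<close>.\<close>
    then show "r_orthogonal H"
      using r_orthogonalI[OF assms(1)] rescaling_trans[OF X(2)] by blast
  }
qed

end
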